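(* For every positive integer $k$ there exist constants $c, C>0$ depending only on $k$ such that every Presburger formula $F(\mathbf{x};\mathbf{y})$ with at most $k$ variables (free and quantified variables counted together) satisfies $$\mathrm{VC}(F)\;\le\; C\,\phi(F)^{c}.$$ (There is no restriction on the number of inequalities in $F$.)
   Context: Presburger Arithmetic (PA) is the first-order theory of the structure $(\mathbb{Z},<,+)$. The atoms of a PA-formula (Presburger formula) are linear inequalities in its variables with integer coefficients and constants, written in binary; all variables, free and quantified, range over $\mathbb{Z}$. The length $\phi(F)$ of a PA-formula $F$ is the total bit length of all symbols, operations, integer coefficients and constants in $F$. VC-dimension: let $X$ be a set and $\mathcal{S}\subseteq 2^X$. A subset $A\subseteq X$ is shattered by $\mathcal{S}$ if for every $B\subseteq A$ there is $S\in\mathcal{S}$ with $B=S\cap A$. $\mathrm{VC}(\mathcal{S})$ is the largest size of a subset of $X$ shattered by $\mathcal{S}$ ($\infty$ if no largest size exists). For a partitioned PA-formula $F(\mathbf{x};\mathbf{y})$, whose free variables are separated into object variables $\mathbf{x}\in\mathbb{Z}^m$ and parameter variables $\mathbf{y}\in\mathbb{Z}^n$, let $S_{b}=\{\mathbf{x}\in\mathbb{Z}^m : F(\mathbf{x};b)\text{ is true}\}$ for $b\in\mathbb{Z}^n$, let $\mathcal{S}_F=\{S_b : b\in\mathbb{Z}^n\}\subseteq 2^{\mathbb{Z}^m}$, and put $\mathrm{VC}(F)=\mathrm{VC}(\mathcal{S}_F)$. *)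

theory Defs
  imports Complex_Main "HOL-Library.Extended_Real" "HOL-Library.Log_Nat"
begin

text \<open>Variables are de Bruijn indices: a quantifier binds index 0 of its body, and the free
  variables are looked up in an environment given as a list of integers.\<close>

datatype pa_term =
    PConst int
  | PMul int nat
  | PAdd pa_term pa_term

datatype pa_formula =
    PLess pa_term pa_term
  | PLe pa_term pa_term
  | PNot pa_formula
  | PAnd pa_formula pa_formula
  | POr pa_formula pa_formula
  | PEx pa_formula
  | PAll pa_formula

primrec pa_eval :: "int list \<Rightarrow> pa_term \<Rightarrow> int" where
  "pa_eval v (PConst c) = c"
| "pa_eval v (PMul a i) = a * v ! i"
| "pa_eval v (PAdd s t) = pa_eval v s + pa_eval v t"

primrec pa_sat :: "int list \<Rightarrow> pa_formula \<Rightarrow> bool" where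
  "pa_sat v (PLess s t) \<longleftrightarrow> pa_eval v s < pa_eval v t"
| "pa_sat v (PLe s t) \<longleftrightarrow> pa_eval v s \<le> pa_eval v t"
| "pa_sat v (PNot F) \<longleftrightarrow> \<not> pa_sat v F"
| "pa_sat v (PAnd F G) \<longleftrightarrow> pa_sat v F \<and> pa_sat v G"
| "pa_sat v (POr F G) \<longleftrightarrow> pa_sat v F \<or> pa_sat v G"
| "pa_sat v (PEx F) \<longleftrightarrow> (\<exists>z. pa_sat (z # v) F)"
| "pa_sat v (PAll F) \<longleftrightarrow> (\<forall>z. pa_sat (z # v) F)"

primrec pa_term_vars :: "pa_term \<Rightarrow> nat set" where
  "pa_term_vars (PConst c) = {}"
| "pa_term_vars (PMul a i) = {i}"
| "pa_term_vars (PAdd s t) = pa_term_vars s \<union> pa_term_vars t"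

primrec pa_free_vars :: "pa_formula \<Rightarrow> nat set" where
  "pa_free_vars (PLess s t) = pa_term_vars s \<union> pa_term_vars t"
| "pa_free_vars (PLe s t) = pa_term_vars s \<union> pa_term_vars t"
| "pa_free_vars (PNot F) = pa_free_vars F"
| "pa_free_vars (PAnd F G) = pa_free_vars F \<union> pa_free_vars G"
| "pa_free_vars (POr F G) = pa_free_vars F \<union> pa_free_vars G"
| "pa_free_vars (PEx F) = {i. Suc i \<in> pa_free_vars F}"
| "pa_free_vars (PAll F) = {i. Suc i \<in> pa_free_vars F}"

text \<open>Every occurrence of a quantifier introduces a variable of its own, so the number of
  quantified variables is the number of quantifier occurrences; a variable name that is
  quantified twice would count as two variables.\<close>

primrec pa_quants :: "pa_formula \<Rightarrow> nat" where
  "pa_quants (PLess s t) = 0"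
| "pa_quants (PLe s t) = 0"
| "pa_quants (PNot F) = pa_quants F"
| "pa_quants (PAnd F G) = pa_quants F + pa_quants G"
| "pa_quants (POr F G) = pa_quants F + pa_quants G"
| "pa_quants (PEx F) = Suc (pa_quants F)"
| "pa_quants (PAll F) = Suc (pa_quants F)"

text \<open>An integer costs its binary digits plus one bit for the sign. Every other symbol, including
  each occurrence of a variable, costs 1; a quantifier is charged together with the variable
  that it binds. With at most \<open>k\<close> variables, a different encoding of the symbols changes the
  length by at most a factor depending only on \<open>k\<close>.\<close>

definition int_length :: "int \<Rightarrow> nat" where
  "int_length a = nat (bitlen \<bar>a\<bar>) + 1"

primrec pa_term_length :: "pa_term \<Rightarrow> nat" where
  "pa_term_length (PConst c) = int_length c"
| "pa_term_length (PMul a i) = int_length a + 1"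
| "pa_term_length (PAdd s t) = pa_term_length s + pa_term_length t + 1"

primrec pa_length :: "pa_formula \<Rightarrow> nat" where
  "pa_length (PLess s t) = pa_term_length s + pa_term_length t + 1"
| "pa_length (PLe s t) = pa_term_length s + pa_term_length t + 1"
| "pa_length (PNot F) = pa_length F + 1"
| "pa_length (PAnd F G) = pa_length F + pa_length G + 1"
| "pa_length (POr F G) = pa_length F + pa_length G + 1"
| "pa_length (PEx F) = pa_length F + 2"
| "pa_length (PAll F) = pa_length F + 2"

definition shattered :: "'a set set \<Rightarrow> 'a set \<Rightarrow> bool" where
  "shattered \<S> A \<longleftrightarrow> (\<forall>B\<subseteq>A. \<exists>S\<in>\<S>. B = S \<inter> A)"

text \<open>Subsets of shattered sets are shattered, so finite sets suffice: an infinite shattered set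
  makes the supremum \<open>\<infinity>\<close>, and a finite supremum is attained.\<close>

definition vc_dim :: "'a set set \<Rightarrow> enat" where
  "vc_dim \<S> = (SUP A \<in> {A. finite A \<and> shattered \<S> A}. enat (card A))"

text \<open>In a partitioned formula \<open>F(x;y)\<close> with \<open>m\<close> object variables and \<open>n\<close> parameter variables,
  the free variables of index less than \<open>m\<close> are the object variables, those from \<open>m\<close> to
  \<open>m + n - 1\<close> the parameter variables. Points of the \<open>m\<close>-dimensional integer lattice are
  integer lists of length \<open>m\<close>.\<close>

definition pa_partitioned :: "nat \<Rightarrow> nat \<Rightarrow> pa_formula \<Rightarrow> bool" where
  "pa_partitioned m n F \<longleftrightarrow> pa_free_vars F \<subseteq> {..<m + n}"

definition pa_set :: "nat \<Rightarrow> pa_formula \<Rightarrow> int list \<Rightarrow> int list set" where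
  "pa_set m F b = {x. length x = m \<and> pa_sat (x @ b) F}"

definition pa_family :: "nat \<Rightarrow> nat \<Rightarrow> pa_formula \<Rightarrow> int list set set" where
  "pa_family m n F = {pa_set m F b |b. length b = n}"

definition pa_vc :: "nat \<Rightarrow> nat \<Rightarrow> pa_formula \<Rightarrow> enat" where
  "pa_vc m n F = vc_dim (pa_family m n F)"

end

theory Submission
  imports Defs "HOL-Library.FuncSet"
begin

text \<open>The truth of a formula \<open>F\<close> at a point depends only on the residues of the coordinates modulo
  some \<open>D\<close> and on the truth of inequalities \<open>h \<cdot> v \<le> c\<close> with \<open>h\<close> in a finite set \<open>H\<close> and
  \<open>\<bar>c\<bar> \<le> K\<close>. Cooper's elimination of a quantifier squares, up to constants, the cardinality of
  \<open>H\<close> and the bit lengths of \<open>D\<close>, \<open>K\<close> and the coefficients, so for boundedly many quantifiers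
  these stay polynomial in the length of \<open>F\<close>. That the constants \<open>c\<close> are exponentially many does
  no harm: on an \<open>N\<close>-element set \<open>A\<close> of object points, the trace of a parameter \<open>y\<close> depends only
  on the residues of \<open>y\<close> and, for every \<open>h \<in> H\<close>, on the position of one integer among
  \<open>N (2 K + 1)\<close> thresholds. Hence a shattered \<open>A\<close> satisfies \<open>2^N \<le> D^n (N (2 K + 1) + 1)^card H\<close>,
  which makes \<open>N\<close> polynomial in the length.\<close>

section \<open>Linear forms, and predicates determined by residues and bounded inequalities\<close>

definition lin :: "(nat \<Rightarrow> int) \<Rightarrow> int list \<Rightarrow> int" where
  "lin h v = (\<Sum>i<length v. h i * v ! i)"

definition agree :: "(nat \<Rightarrow> int) set \<Rightarrow> int \<Rightarrow> int \<Rightarrow> int list \<Rightarrow> int list \<Rightarrow> bool" where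
  "agree H K D v w \<longleftrightarrow>
    (\<forall>i<length v. D dvd v ! i - w ! i) \<and>
    (\<forall>h\<in>H. \<forall>c. \<bar>c\<bar> \<le> K \<longrightarrow> (lin h v \<le> c \<longleftrightarrow> lin h w \<le> c))"

definition determined ::
  "nat \<Rightarrow> (nat \<Rightarrow> int) set \<Rightarrow> int \<Rightarrow> int \<Rightarrow> (int list \<Rightarrow> bool) \<Rightarrow> bool" where
  "determined s H K D P \<longleftrightarrow>
    (\<forall>v w. length v = s \<and> length w = s \<and> agree H K D v w \<longrightarrow> P v = P w)"

text \<open>A single number \<open>R\<close> bounds the count of forms and, as a bit length, the
  coefficients, the thresholds and the period, so that each logical operation acts on one
  parameter.\<close>

definition complexity_le :: "nat \<Rightarrow> nat \<Rightarrow> (int list \<Rightarrow> bool) \<Rightarrow> bool" where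
  "complexity_le R s P \<longleftrightarrow>
    (\<exists>H D. finite H \<and> card H \<le> R \<and> (\<forall>h\<in>H. \<forall>i. \<bar>h i\<bar> \<le> 2 ^ R) \<and>
      1 \<le> D \<and> D \<le> 2 ^ R \<and> determined s H (2 ^ R) D P)"

lemma lin_Cons: "lin h (z # v) = h 0 * z + lin (\<lambda>i. h (Suc i)) v"
  by (simp add: lin_def sum.lessThan_Suc_shift del: sum.lessThan_Suc)

lemma lin_append: "lin h (x @ y) = lin h x + lin (\<lambda>i. h (length x + i)) y"
  by (induction x arbitrary: h) (simp_all add: lin_Cons, simp add: lin_def)

lemma lin_diff: "lin (\<lambda>i. g i - h i) v = lin g v - lin h v"
  by (simp add: lin_def left_diff_distrib sum_subtractf)

lemma lin_add: "lin (\<lambda>i. g i + h i) v = lin g v + lin h v"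
  by (simp add: lin_def distrib_right sum.distrib)

lemma lin_scale: "lin (\<lambda>i. a * h i) v = a * lin h v"
  by (simp add: lin_def sum_distrib_left mult.assoc)

lemma lin_cong_mod:
  assumes "length v = length w" "\<forall>i<length v. D dvd v ! i - w ! i"
  shows "D dvd lin h v - lin h w"
proof -
  have "lin h v - lin h w = (\<Sum>i<length v. h i * (v ! i - w ! i))"
    by (simp add: lin_def assms(1) right_diff_distrib sum_subtractf)
  then show ?thesis
    using assms(2) by (auto intro!: dvd_sum)
qed

lemma agree_mono:
  assumes "agree H' K' D' v w" "H \<subseteq> H'" "K \<le> K'" "D dvd D'"
  shows "agree H K D v w"
  using assms unfolding agree_def by (meson dvd_trans order_trans subsetD)

lemma agree_sym: "length v = length w \<Longrightarrow> agree H K D v w \<Longrightarrow> agree H K D w v"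
  unfolding agree_def by (metis dvd_diff_commute)

lemma determined_mono:
  assumes "determined s H K D P" "H \<subseteq> H'" "K \<le> K'" "D dvd D'"
  shows "determined s H' K' D' P"
  using assms agree_mono unfolding determined_def by blast

section \<open>Elimination of one existential quantifier\<close>

text \<open>One half of a back-and-forth argument: \<open>agree\<close> is symmetric on lists of
  equal length, so carrying witnesses from \<open>v\<close> to \<open>w\<close> suffices.\<close>

lemma determined_exI:
  assumes "\<And>v w z. length v = s \<Longrightarrow> length w = s \<Longrightarrow> agree H' K' D' v w \<Longrightarrow>
      \<exists>z'. agree H K D (z # v) (z' # w)"
    and "determined (Suc s) H K D P"
  shows "determined s H' K' D' (\<lambda>v. \<exists>z. P (z # v))"
proof -
  have imp: "\<exists>z'. P (z' # w)"
    if "length v = s" "length w = s" "agree H' K' D' v w" "P (z # v)" for v w z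
    using assms(1)[OF that(1-3), of z] assms(2) that unfolding determined_def
    by (metis length_Cons)
  show ?thesis
    unfolding determined_def using imp agree_sym by metis
qed

text \<open>The step of Cooper's algorithm: a witness can be moved, within its residue class, down to
  within one period of the largest breakpoint below it, or far below all breakpoints.\<close>

lemma move_witness:
  fixes tv tw :: "'i \<Rightarrow> int" and A D z :: int
  assumes "finite I" and A: "A > 0" and D: "D > 0"
    and cong: "\<And>i. i \<in> I \<Longrightarrow> A * D dvd tv i - tw i"
    and order: "\<And>i k j. i \<in> I \<Longrightarrow> k \<in> I \<Longrightarrow> 0 \<le> j \<Longrightarrow> j < A * D \<Longrightarrow>
      tv k \<le> tv i + j \<longleftrightarrow> tw k \<le> tw i + j"
  shows "\<exists>z'. D dvd z - z' \<and> (\<forall>k\<in>I. tv k \<le> A * z \<longleftrightarrow> tw k \<le> A * z')"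
proof (cases "\<exists>i\<in>I. tv i \<le> A * z")
  case False
  \<comment> \<open>Going down by \<open>q\<close> periods keeps the residue modulo \<open>D\<close>
    and passes below every \<open>tw k\<close>.\<close>
  define q where "q = \<bar>z\<bar> + (\<Sum>k\<in>I. \<bar>tw k\<bar>) + 1"
  have "tw k > A * (z - D * q)" if "k \<in> I" for k
  proof -
    define S where "S = (\<Sum>k\<in>I. \<bar>tw k\<bar>)"
    have k: "\<bar>tw k\<bar> \<le> S"
      unfolding S_def using \<open>finite I\<close> that by (intro member_le_sum) auto
    have "q \<le> D * q"
      using D k mult_right_mono[of 1 D q] by (simp add: q_def flip: S_def)
    then have *: "z - D * q \<le> - (S + 1)"
      unfolding q_def S_def by linarith
    have "A * (z - D * q) \<le> A * (- (S + 1))"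
      using A * by (intro mult_left_mono) auto
    also have "\<dots> \<le> - (S + 1)"
      using A k mult_right_mono[of 1 A "S + 1"] by (simp add: algebra_simps)
    finally show ?thesis using k by linarith
  qed
  then show ?thesis
    using False by (intro exI[of _ "z - D * q"]) (auto dest: leD)
next
  case True
  define J where "J = {i \<in> I. tv i \<le> A * z}"
  have J: "finite J" "J \<noteq> {}"
    using True \<open>finite I\<close> by (auto simp: J_def)
  have "Max (tv ` J) \<in> tv ` J"
    using J by (intro Max_in) auto
  then obtain i where "i \<in> J" "tv i = Max (tv ` J)"
    by auto
  then have i: "i \<in> J" "\<And>k. k \<in> J \<Longrightarrow> tv k \<le> tv i"
    using J(1) by auto
  define u where "u = A * z - tv i"
  \<comment> \<open>Dropping whole periods leaves an offset below \<open>A * D\<close>, the only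
    range in which \<open>order\<close> is available.\<close>
  define j where "j = u mod (A * D)"
  have AD: "A * D > 0" using A D by simp
  have "u \<ge> 0" using i(1) by (simp add: u_def J_def)
  have j: "0 \<le> j" "j < A * D" "j \<le> u"
    using AD \<open>u \<ge> 0\<close> by (auto simp: j_def zmod_le_nonneg_dividend)
  have "i \<in> I" using i(1) by (simp add: J_def)
  obtain r where r: "tv i - tw i = A * D * r"
    using cong[OF \<open>i \<in> I\<close>] by (auto elim: dvdE)
  \<comment> \<open>Chosen so that \<open>A * z' = tw i + j\<close>. That \<open>z'\<close> is an
    integer congruent to \<open>z\<close> modulo \<open>D\<close> is why the breakpoints must agree
    modulo \<open>A * D\<close> and not only modulo \<open>D\<close>.\<close>
  define z' where "z' = z - D * (u div (A * D)) - D * r"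
  have "u = A * D * (u div (A * D)) + j"
    by (simp add: j_def)
  then have z': "A * z' = tw i + j"
    using r by (simp add: z'_def u_def algebra_simps)
  have "tv k \<le> A * z \<longleftrightarrow> tw k \<le> A * z'" if "k \<in> I" for k
  proof -
    have "tv k \<le> A * z \<longleftrightarrow> tv k \<le> tv i + j"
      using i(2)[of k] j that unfolding J_def u_def by auto
    then show ?thesis
      using order[OF \<open>i \<in> I\<close> that j(1,2)] z' by simp
  qed
  moreover have "D dvd z - z'"
    by (simp add: z'_def)
  ultimately show ?thesis by blast
qed

text \<open>A common multiple of the nonzero leading coefficients, in the role of the least common
  multiple in Cooper's algorithm. The default factor 1 keeps it positive.\<close>

definition lead_prod :: "(nat \<Rightarrow> int) set \<Rightarrow> int" where
  "lead_prod H = (\<Prod>h\<in>H. if h 0 = 0 then 1 else \<bar>h 0\<bar>)"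

text \<open>Multiplied by \<open>lead_prod H div \<bar>h 0\<bar>\<close>, the inequality \<open>lin h (z # v) \<le> c\<close> compares
  \<open>lead_prod H * z\<close> with the breakpoint \<open>lin (bp_form H h) v + bp_const H h c\<close>.\<close>

definition bp_form :: "(nat \<Rightarrow> int) set \<Rightarrow> (nat \<Rightarrow> int) \<Rightarrow> nat \<Rightarrow> int" where
  "bp_form H h i = - sgn (h 0) * (lead_prod H div \<bar>h 0\<bar>) * h (Suc i)"

definition bp_const :: "(nat \<Rightarrow> int) set \<Rightarrow> (nat \<Rightarrow> int) \<Rightarrow> int \<Rightarrow> int" where
  "bp_const H h c = (lead_prod H div \<bar>h 0\<bar>) * (if h 0 > 0 then c + 1 else - c)"

text \<open>Forms free of the eliminated variable survive; the others contribute pairwise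
  differences, since comparing two shifted breakpoints is an inequality on the difference of their
  forms.\<close>

definition elim_forms :: "(nat \<Rightarrow> int) set \<Rightarrow> (nat \<Rightarrow> int) set" where
  "elim_forms H = (\<lambda>h i. h (Suc i)) ` {h \<in> H. h 0 = 0} \<union>
    (\<lambda>(h, g) i. bp_form H h i - bp_form H g i) ` ({h \<in> H. h 0 \<noteq> 0} \<times> {h \<in> H. h 0 \<noteq> 0})"

lemma lead_prod_ge_1: "lead_prod H \<ge> 1"
  unfolding lead_prod_def by (intro prod_ge_1) auto

lemma lead_prod_le:
  assumes "\<And>h. h \<in> H \<Longrightarrow> \<bar>h 0\<bar> \<le> B" "1 \<le> B"
  shows "lead_prod H \<le> B ^ card H"
proof -
  have "lead_prod H \<le> (\<Prod>h\<in>H. B)"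
    unfolding lead_prod_def using assms by (intro prod_mono) auto
  then show ?thesis by simp
qed

lemma lead_prod_div:
  assumes "finite H" "h \<in> H" "h 0 \<noteq> 0"
  shows "(lead_prod H div \<bar>h 0\<bar>) * \<bar>h 0\<bar> = lead_prod H"
    and "1 \<le> lead_prod H div \<bar>h 0\<bar>" and "lead_prod H div \<bar>h 0\<bar> \<le> lead_prod H"
proof -
  have "\<bar>h 0\<bar> dvd lead_prod H"
    unfolding lead_prod_def using dvd_prodI[OF assms(1,2), of "\<lambda>h. if h 0 = 0 then 1 else \<bar>h 0\<bar>"] assms(3)
    by simp
  then show *: "(lead_prod H div \<bar>h 0\<bar>) * \<bar>h 0\<bar> = lead_prod H" by simp
  show "1 \<le> lead_prod H div \<bar>h 0\<bar>"
    using * lead_prod_ge_1[of H] by (smt (verit) mult_nonneg_nonneg mult_nonpos_nonneg)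
  then show "lead_prod H div \<bar>h 0\<bar> \<le> lead_prod H"
    using * assms(3) by (metis mult_le_cancel_left1 abs_ge_zero int_one_le_iff_zero_less order_less_imp_not_less zero_less_abs_iff linorder_not_less less_le_trans zero_less_one)
qed

text \<open>A negative leading coefficient makes the inequality a lower bound on \<open>z\<close>. A
  positive one makes its negation \<open>lin h (z # v) \<ge> c + 1\<close> a lower bound, hence the
  \<open>c + 1\<close> in \<open>bp_const\<close>. All breakpoints thus face the same way.\<close>

lemma le_iff_breakpoint:
  assumes "finite H" "h \<in> H" "h 0 \<noteq> 0"
  shows "lin h (z # v) \<le> c \<longleftrightarrow>
    (lin (bp_form H h) v + bp_const H h c \<le> lead_prod H * z \<longleftrightarrow> h 0 < 0)"
proof -
  define e where "e = lead_prod H div \<bar>h 0\<bar>"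
  define l where "l = lin (\<lambda>i. h (Suc i)) v"
  have e: "e * \<bar>h 0\<bar> = lead_prod H" "e > 0"
    using lead_prod_div[OF assms] by (auto simp: e_def)
  have bp: "lin (bp_form H h) v = - sgn (h 0) * e * l"
    unfolding l_def bp_form_def[abs_def] e_def[symmetric] by (rule lin_scale)
  have scale: "e * a \<le> e * b \<longleftrightarrow> a \<le> b" for a b :: int
    using e(2) by simp
  show ?thesis
  proof (cases "h 0 > 0")
    case True
    then have "lin (bp_form H h) v + bp_const H h c \<le> lead_prod H * z \<longleftrightarrow>
        e * (c + 1 - l) \<le> e * (h 0 * z)"
      using e(1) unfolding bp bp_const_def e_def[symmetric] by (simp add: algebra_simps flip: e(1))
    then show ?thesis
      using True unfolding scale lin_Cons l_def[symmetric] by auto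
  next
    case False
    then have neg: "h 0 < 0" using assms(3) by simp
    then have "lin (bp_form H h) v + bp_const H h c \<le> lead_prod H * z \<longleftrightarrow>
        e * (l - c) \<le> e * (- h 0 * z)"
      using e(1) unfolding bp bp_const_def e_def[symmetric] by (simp add: algebra_simps flip: e(1))
    then show ?thesis
      using neg unfolding scale lin_Cons l_def[symmetric] by auto
  qed
qed

lemma bp_const_bound:
  assumes "finite H" "h \<in> H" "h 0 \<noteq> 0" "\<bar>c\<bar> \<le> K"
  shows "\<bar>bp_const H h c\<bar> \<le> lead_prod H * (K + 1)"
proof -
  have "\<bar>bp_const H h c\<bar> = (lead_prod H div \<bar>h 0\<bar>) * \<bar>if h 0 > 0 then c + 1 else - c\<bar>"
    using lead_prod_div(2)[OF assms(1-3)] by (simp add: bp_const_def abs_mult)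
  also have "\<dots> \<le> lead_prod H * (K + 1)"
    using lead_prod_div(2,3)[OF assms(1-3)] assms(4) by (intro mult_mono) auto
  finally show ?thesis .
qed

lemma bp_form_bound:
  assumes "finite H" "h \<in> H" "h 0 \<noteq> 0" "\<And>i. \<bar>h i\<bar> \<le> B"
  shows "\<bar>bp_form H h i\<bar> \<le> lead_prod H * B"
proof -
  have "\<bar>bp_form H h i\<bar> = (lead_prod H div \<bar>h 0\<bar>) * \<bar>h (Suc i)\<bar>"
    using lead_prod_div(2)[OF assms(1-3)] assms(3) by (simp add: bp_form_def abs_mult abs_sgn_eq)
  also have "\<dots> \<le> lead_prod H * B"
    using lead_prod_div(2,3)[OF assms(1-3)] assms(4) by (intro mult_mono) auto
  finally show ?thesis .
qed

text \<open>The bound on \<open>K'\<close> adds up two breakpoint constants, each at most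
  \<open>lead_prod H * (K + 1)\<close>, and a shift below \<open>lead_prod H * D\<close>.\<close>

lemma determined_ex:
  assumes "finite H" "D \<ge> 1" "determined (Suc s) H K D P" "K \<le> K'"
    and K': "2 * lead_prod H * (K + 1) + lead_prod H * D \<le> K'"
  shows "determined s (elim_forms H) K' (lead_prod H * D) (\<lambda>v. \<exists>z. P (z # v))"
proof (rule determined_exI[OF _ assms(3)])
  fix v w :: "int list" and z :: int
  assume len: "length v = s" "length w = s"
    and ag: "agree (elim_forms H) K' (lead_prod H * D) v w"
  define A where "A = lead_prod H"
  define I where "I = {h \<in> H. h 0 \<noteq> 0} \<times> {-K..K}"
  define t where "t x = (\<lambda>(h, c). lin (bp_form H h) x + bp_const H h c)" for x
  have A: "A \<ge> 1" by (simp add: A_def lead_prod_ge_1)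
  have "\<exists>z'. D dvd z - z' \<and> (\<forall>k\<in>I. t v k \<le> A * z \<longleftrightarrow> t w k \<le> A * z')"
  proof (rule move_witness)
    show "finite I" using \<open>finite H\<close> by (simp add: I_def)
    show "A > 0" "D > 0" using A assms(2) by auto
    show "A * D dvd t v i - t w i" for i
      using lin_cong_mod[of v w "A * D"] ag len
      by (auto simp: t_def agree_def A_def split: prod.split)
    show "t v k \<le> t v i + j \<longleftrightarrow> t w k \<le> t w i + j"
      if ik: "i \<in> I" "k \<in> I" and j: "0 \<le> j" "j < A * D" for i k j
    proof -
      obtain h c g d where eq: "i = (h, c)" "k = (g, d)" by fastforce
      \<comment> \<open>The constants \<open>c\<close>, \<open>d\<close> and the shift
        \<open>j\<close> all go into the threshold, so the new form depends on \<open>g\<close> and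
        \<open>h\<close> alone. Hence the many breakpoints in \<open>I\<close> produce only
        quadratically many forms.\<close>
      define b where "b = j + bp_const H h c - bp_const H g d"
      have mem: "h \<in> H" "h 0 \<noteq> 0" "\<bar>c\<bar> \<le> K" "g \<in> H" "g 0 \<noteq> 0" "\<bar>d\<bar> \<le> K"
        using ik by (auto simp: eq I_def)
      have "\<bar>b\<bar> \<le> K'"
        using bp_const_bound[OF \<open>finite H\<close> mem(1-3)] bp_const_bound[OF \<open>finite H\<close> mem(4-6)] j K'
        unfolding b_def A_def by linarith
      moreover have "(\<lambda>i. bp_form H g i - bp_form H h i) \<in> elim_forms H"
        using mem by (auto simp: elim_forms_def)
      ultimately have "lin (\<lambda>i. bp_form H g i - bp_form H h i) v \<le> b \<longleftrightarrow>
          lin (\<lambda>i. bp_form H g i - bp_form H h i) w \<le> b"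
        using ag unfolding agree_def by blast
      then show ?thesis
        unfolding lin_diff eq t_def b_def by auto
    qed
  qed
  then obtain z' where z': "D dvd z - z'" "\<And>k. k \<in> I \<Longrightarrow> t v k \<le> A * z \<longleftrightarrow> t w k \<le> A * z'"
    by blast
  have "lin h (z # v) \<le> c \<longleftrightarrow> lin h (z' # w) \<le> c" if "h \<in> H" "\<bar>c\<bar> \<le> K" for h c
  proof (cases "h 0 = 0")
    case True
    then have "(\<lambda>i. h (Suc i)) \<in> elim_forms H"
      using that by (auto simp: elim_forms_def)
    then show ?thesis
      using ag that assms(4) True by (auto simp: agree_def lin_Cons)
  next
    case False
    then show ?thesis
      using z'(2)[of "(h, c)"] that
      by (simp add: le_iff_breakpoint[OF \<open>finite H\<close>] t_def A_def I_def abs_le_iff)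
  qed
  moreover have "D dvd (z # v) ! i - (z' # w) ! i" if "i < length (z # v)" for i
    using ag z'(1) that by (cases i) (auto simp: agree_def dest: dvd_mult_right)
  ultimately show "\<exists>z'. agree H K D (z # v) (z' # w)"
    unfolding agree_def by blast
qed

lemma finite_elim_forms: "finite H \<Longrightarrow> finite (elim_forms H)"
  by (simp add: elim_forms_def)

lemma card_elim_forms:
  assumes "finite H"
  shows "card (elim_forms H) \<le> card H + card H * card H"
proof -
  have le: "card {h \<in> H. Q h} \<le> card H" for Q
    using assms by (intro card_mono) auto
  have "card ((\<lambda>h i. h (Suc i)) ` {h \<in> H. h 0 = 0}) \<le> card H"
    using card_image_le[of "{h \<in> H. h 0 = 0}"] le assms order_trans by fastforce
  moreover have "card ((\<lambda>(h, g) i. bp_form H h i - bp_form H g i) `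
      ({h \<in> H. h 0 \<noteq> 0} \<times> {h \<in> H. h 0 \<noteq> 0})) \<le> card H * card H"
    using assms le
    by (intro order_trans[OF card_image_le]) (auto simp: card_cartesian_product intro!: mult_le_mono)
  ultimately show ?thesis
    unfolding elim_forms_def by (intro order_trans[OF card_Un_le] add_mono)
qed

lemma elim_forms_bound:
  assumes "finite H" "\<And>h i. h \<in> H \<Longrightarrow> \<bar>h i\<bar> \<le> B" "f \<in> elim_forms H" "B \<ge> 0"
  shows "\<bar>f i\<bar> \<le> 2 * lead_prod H * B"
  using assms(3) unfolding elim_forms_def
proof (elim UnE imageE)
  fix h assume h: "f = (\<lambda>i. h (Suc i))" "h \<in> {h \<in> H. h 0 = 0}"
  have "1 * B \<le> 2 * lead_prod H * B"
    using lead_prod_ge_1[of H] assms(4) by (intro mult_right_mono) auto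
  then show ?thesis
    using assms(2)[of h "Suc i"] h by auto
next
  fix p assume p: "f = (case p of (h, g) \<Rightarrow> \<lambda>i. bp_form H h i - bp_form H g i)"
    "p \<in> {h \<in> H. h 0 \<noteq> 0} \<times> {h \<in> H. h 0 \<noteq> 0}"
  obtain h g where hg: "p = (h, g)" by fastforce
  show ?thesis
    using bp_form_bound[OF assms(1), of h B i] bp_form_bound[OF assms(1), of g B i] p assms(2)
    by (auto simp: hg)
qed

section \<open>Complexity under connectives and quantifiers\<close>

lemma complexity_le_not: "complexity_le R s P \<Longrightarrow> complexity_le R s (\<lambda>v. \<not> P v)"
  by (simp add: complexity_le_def determined_def)

lemma complexity_le_mono:
  assumes "complexity_le R s P" "R \<le> R'"
  shows "complexity_le R' s P"
proof -
  have "(2 :: int) ^ R \<le> 2 ^ R'" using assms(2) by simp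
  then show ?thesis
    using assms determined_mono[OF _ subset_refl _ dvd_refl]
    unfolding complexity_le_def by (meson order_trans)
qed

text \<open>The union of the two sets of forms and the product of the two periods serve both
  predicates; cardinalities and bit lengths add.\<close>

lemma complexity_le_combine:
  assumes "complexity_le R s P" "complexity_le R' s Q"
    and cong: "\<And>v w. length v = s \<Longrightarrow> length w = s \<Longrightarrow> P v = P w \<Longrightarrow> Q v = Q w \<Longrightarrow> S v = S w"
  shows "complexity_le (R + R') s S"
proof -
  obtain H D where H: "finite H" "card H \<le> R" "\<forall>h\<in>H. \<forall>i. \<bar>h i\<bar> \<le> 2 ^ R"
      "1 \<le> D" "D \<le> 2 ^ R" "determined s H (2 ^ R) D P"
    using assms(1) unfolding complexity_le_def by blast
  obtain H' D' where H': "finite H'" "card H' \<le> R'" "\<forall>h\<in>H'. \<forall>i. \<bar>h i\<bar> \<le> 2 ^ R'"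
      "1 \<le> D'" "D' \<le> 2 ^ R'" "determined s H' (2 ^ R') D' Q"
    using assms(2) unfolding complexity_le_def by blast
  have le: "(2 :: int) ^ R \<le> 2 ^ (R + R')" "(2 :: int) ^ R' \<le> 2 ^ (R + R')" by simp_all
  have "determined s (H \<union> H') (2 ^ (R + R')) (D * D') P"
    by (rule determined_mono[OF H(6)]) (use le in auto)
  moreover have "determined s (H \<union> H') (2 ^ (R + R')) (D * D') Q"
    by (rule determined_mono[OF H'(6)]) (use le in auto)
  ultimately have "determined s (H \<union> H') (2 ^ (R + R')) (D * D') S"
    unfolding determined_def using cong by blast
  moreover have "card (H \<union> H') \<le> R + R'"
    using card_Un_le[of H H'] H(2) H'(2) by linarith
  moreover have "\<forall>h\<in>H \<union> H'. \<forall>i. \<bar>h i\<bar> \<le> 2 ^ (R + R')"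
    using H(3) H'(3) le by (meson UnE order_trans)
  moreover have "1 \<le> D * D'"
    using H(4) H'(4) by (metis mult_mono' mult_1 zero_le_one)
  moreover have "D * D' \<le> 2 ^ (R + R')"
    unfolding power_add using H(4,5) H'(4,5) by (intro mult_mono) auto
  ultimately show ?thesis
    unfolding complexity_le_def using H(1) H'(1) by blast
qed

text \<open>The dominant term is \<open>lead_prod H\<close>, a product of at most \<open>R\<close>
  factors of at most \<open>R\<close> bits each; the factor 6 absorbs the lower-order terms.\<close>

lemma complexity_le_ex:
  assumes "complexity_le R (Suc s) P" "R \<ge> 1"
  shows "complexity_le (6 * R\<^sup>2) s (\<lambda>v. \<exists>z. P (z # v))"
proof -
  obtain H D where H: "finite H" "card H \<le> R" "\<forall>h\<in>H. \<forall>i. \<bar>h i\<bar> \<le> 2 ^ R"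
      "1 \<le> D" "D \<le> 2 ^ R" "determined (Suc s) H (2 ^ R) D P"
    using assms(1) unfolding complexity_le_def by blast
  define A where "A = lead_prod H"
  have R: "R \<le> R * R" using assms(2) by simp
  have "A \<le> (2 ^ R) ^ card H"
    unfolding A_def using H(3) by (intro lead_prod_le) auto
  also have "\<dots> \<le> (2 ^ R) ^ R"
    using H(2) by (intro power_increasing) auto
  finally have A: "1 \<le> A" "A \<le> 2 ^ (R * R)"
    by (simp_all add: power_mult A_def lead_prod_ge_1)
  have exp: "(2 :: int) ^ n \<le> 2 ^ (6 * R\<^sup>2)" if "n \<le> R * R + R + 3" for n
    using that R assms(2) unfolding power2_eq_square by (intro power_increasing; linarith)
  \<comment> \<open>The right-hand side is \<open>5 * A * 2 ^ R\<close>; rounding 5 up to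
    \<open>8 = 2 ^ 3\<close> gives the exponent \<open>R * R + R + 3\<close>.\<close>
  have "2 * A * (2 ^ R + 1) + A * D \<le> 2 * A * (2 ^ R + 2 ^ R) + A * 2 ^ R"
    using A H(5) by (intro add_mono mult_left_mono) auto
  also have "\<dots> \<le> A * 2 ^ R * 8"
    using A(1) by simp
  also have "\<dots> \<le> 2 ^ (R * R) * 2 ^ R * 8"
    using A by (intro mult_right_mono) auto
  also have "\<dots> = 2 ^ (R * R + R + 3)"
    by (simp add: power_add)
  also note exp
  finally have K: "2 * A * (2 ^ R + 1) + A * D \<le> 2 ^ (6 * R\<^sup>2)" by simp
  have det: "determined s (elim_forms H) (2 ^ (6 * R\<^sup>2)) (A * D) (\<lambda>v. \<exists>z. P (z # v))"
    unfolding A_def using K by (intro determined_ex[OF H(1,4,6)] exp) (simp_all add: A_def)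
  have "card (elim_forms H) \<le> R + R * R"
    using card_elim_forms[OF H(1)] H(2) mult_le_mono[OF H(2) H(2)] by linarith
  then have card: "card (elim_forms H) \<le> 6 * R\<^sup>2"
    using R unfolding power2_eq_square by linarith
  have AD: "0 \<le> 2 * A * (2 ^ R + 1)" "1 * 1 \<le> A * D"
    using A(1) H(4) by (simp, intro mult_mono) auto
  have "\<bar>f i\<bar> \<le> 2 ^ (6 * R\<^sup>2)" if "f \<in> elim_forms H" for f i
  proof -
    have "\<bar>f i\<bar> \<le> 2 * A * 2 ^ R"
      unfolding A_def using H(1,3) that by (intro elim_forms_bound) auto
    also have "\<dots> \<le> 2 * A * (2 ^ R + 1)"
      using A(1) by (intro mult_left_mono) auto
    finally show ?thesis using K AD by linarith
  qed
  then show ?thesis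
    unfolding complexity_le_def using det card K AD finite_elim_forms[OF H(1)]
    by (intro exI[of _ "elim_forms H"] exI[of _ "A * D"]) auto
qed

section \<open>Atoms as linear inequalities and the sizes of their coefficients\<close>

primrec term_coeff :: "pa_term \<Rightarrow> nat \<Rightarrow> int" where
  "term_coeff (PConst c) i = 0"
| "term_coeff (PMul a j) i = (if i = j then a else 0)"
| "term_coeff (PAdd s t) i = term_coeff s i + term_coeff t i"

primrec term_const :: "pa_term \<Rightarrow> int" where
  "term_const (PConst c) = c"
| "term_const (PMul a j) = 0"
| "term_const (PAdd s t) = term_const s + term_const t"

lemma pa_eval_eq_lin:
  "pa_term_vars t \<subseteq> {..<length v} \<Longrightarrow> pa_eval v t = lin (term_coeff t) v + term_const t"
proof (induction t)
  case (PMul a j)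
  have "lin (term_coeff (PMul a j)) v = (\<Sum>i<length v. if i = j then a * v ! j else 0)"
    unfolding lin_def by (intro sum.cong) auto
  with PMul show ?case by (simp del: term_coeff.simps)
next
  case (PAdd s t)
  have "term_coeff (PAdd s t) = (\<lambda>i. term_coeff s i + term_coeff t i)"
    by auto
  with PAdd show ?case by (simp add: lin_add)
qed (simp add: lin_def)

lemma abs_less_int_length: "\<bar>a\<bar> < 2 ^ int_length a"
proof -
  have "\<bar>a\<bar> < 2 ^ nat (bitlen \<bar>a\<bar>)"
    using bitlen_bounds[of "\<bar>a\<bar>"] by (cases "a = 0") (auto simp: bitlen_def)
  also have "\<dots> \<le> (2 :: int) ^ int_length a"
    by (simp add: int_length_def)
  finally show ?thesis .
qed

text \<open>Follows from \<open>(2 ^ p - 1) * (2 ^ q - 1) \<ge> 0\<close>. It matches the additivity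
  of \<open>pa_term_length\<close>.\<close>

lemma add_less_power2:
  fixes a b :: int
  assumes "\<bar>a\<bar> < 2 ^ p" "\<bar>b\<bar> < 2 ^ q"
  shows "\<bar>a + b\<bar> < 2 ^ (p + q)"
proof -
  have "\<bar>a + b\<bar> \<le> (2 ^ p - 1) + (2 ^ q - 1)"
    using assms by linarith
  also have "\<dots> \<le> 2 ^ (p + q) - (1 :: int)"
    using mult_nonneg_nonneg[of "2 ^ p - (1 :: int)" "2 ^ q - 1"]
    by (simp add: power_add algebra_simps)
  finally show ?thesis by linarith
qed

lemma term_bounds:
  "\<bar>term_coeff t i\<bar> < 2 ^ pa_term_length t" "\<bar>term_const t\<bar> < 2 ^ pa_term_length t"
proof (induction t)
  case (PConst c)
  { case 1 show ?case by simp next case 2 show ?case by (simp add: abs_less_int_length) }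
next
  case (PMul a j)
  { case 1 show ?case using abs_less_int_length[of a] by (auto intro: less_trans)
    next case 2 show ?case by simp }
next
  case (PAdd s t)
  { case 1 show ?case using add_less_power2[OF PAdd(1,3)] by simp
    next case 2 show ?case using add_less_power2[OF PAdd(2,4)] by simp }
qed

lemma complexity_le_lin:
  assumes "\<And>v. length v = s \<Longrightarrow> P v \<longleftrightarrow> lin h v \<le> c"
    and "\<And>i. \<bar>h i\<bar> \<le> 2 ^ R" "\<bar>c\<bar> \<le> 2 ^ R" "R \<ge> 1"
  shows "complexity_le R s P"
  unfolding complexity_le_def determined_def agree_def
  by (intro exI[of _ "{h}"] exI[of _ 1]) (use assms in auto)

lemma complexity_le_atom:
  assumes "pa_term_vars s \<union> pa_term_vars t \<subseteq> {..<n}"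
  shows "complexity_le (pa_term_length s + pa_term_length t + 1) n (\<lambda>v. pa_eval v s \<le> pa_eval v t)"
    and "complexity_le (pa_term_length s + pa_term_length t + 1) n (\<lambda>v. pa_eval v s < pa_eval v t)"
proof -
  let ?R = "pa_term_length s + pa_term_length t"
  have h: "\<bar>term_coeff s i - term_coeff t i\<bar> \<le> 2 ^ (?R + 1)" for i
    using add_less_power2[OF term_bounds(1)[of s i], of "- term_coeff t i" "pa_term_length t"]
      term_bounds(1)[of t i] by simp
  have c: "\<bar>term_const t - term_const s\<bar> < 2 ^ ?R"
    using add_less_power2[of "- term_const s" "pa_term_length s", OF _ term_bounds(2)[of t]]
      term_bounds(2)[of s] by simp
  \<comment> \<open>The second bound is for the strict atom, which over the integers is the
    non-strict one with its threshold lowered by 1.\<close>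
  then have c': "\<bar>term_const t - term_const s\<bar> \<le> 2 ^ (?R + 1)"
      "\<bar>term_const t - term_const s - 1\<bar> \<le> 2 ^ (?R + 1)"
    by auto
  have ev: "pa_eval v s = lin (term_coeff s) v + term_const s"
      "pa_eval v t = lin (term_coeff t) v + term_const t" if "length v = n" for v
    using assms that by (auto intro!: pa_eval_eq_lin)
  show "complexity_le (?R + 1) n (\<lambda>v. pa_eval v s \<le> pa_eval v t)"
    by (rule complexity_le_lin[where h = "\<lambda>i. term_coeff s i - term_coeff t i"
          and c = "term_const t - term_const s", OF _ h c'(1)])
      (auto simp: ev lin_diff)
  show "complexity_le (?R + 1) n (\<lambda>v. pa_eval v s < pa_eval v t)"
    by (rule complexity_le_lin[where h = "\<lambda>i. term_coeff s i - term_coeff t i"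
          and c = "term_const t - term_const s - 1", OF _ h c'(2)])
      (auto simp: ev lin_diff)
qed

section \<open>Complexity of a formula in terms of its length and number of quantifiers\<close>

lemma pa_length_ge_1: "pa_length F \<ge> 1"
  by (induction F) auto

text \<open>With \<open>x\<close> at least 6, \<open>6 * x\<^sup>2\<close> is at most the cube of
  \<open>x\<close>: this explains the base \<open>6 * l\<close> and the tripling of the exponent per
  quantifier.\<close>

lemma tower_quantifier_step:
  fixes l q :: nat
  assumes l: "l \<ge> 1"
  shows "6 * ((6 * l) ^ 3 ^ q)\<^sup>2 \<le> (6 * (l + 2)) ^ 3 ^ Suc q"
proof -
  let ?x = "(6 * l) ^ 3 ^ q"
  have "6 \<le> (6 * l) ^ 1" using l by simp
  also have "\<dots> \<le> ?x" using l by (intro power_increasing) auto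
  finally have "6 * ?x\<^sup>2 \<le> ?x * ?x\<^sup>2" by (intro mult_right_mono) auto
  also have "\<dots> = (6 * l) ^ 3 ^ Suc q"
    by (simp only: power_Suc2 power_mult power2_eq_square power3_eq_cube mult.assoc)
  also have "\<dots> \<le> (6 * (l + 2)) ^ 3 ^ Suc q"
    by (intro power_mono) auto
  finally show ?thesis .
qed

text \<open>Both powers are raised to a common exponent, where superadditivity of positive powers
  applies.\<close>

lemma tower_connective_step:
  fixes q1 q2 l1 l2 :: nat
  shows "(6 * l1) ^ 3 ^ q1 + (6 * l2) ^ 3 ^ q2 \<le> (6 * (l1 + l2 + 1)) ^ 3 ^ (q1 + q2)"
proof -
  have superadd: "a ^ Suc n + b ^ Suc n \<le> (a + b) ^ Suc n" for a b n :: nat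
  proof -
    have "a * a ^ n + b * b ^ n \<le> a * (a + b) ^ n + b * (a + b) ^ n"
      by (intro add_mono mult_left_mono power_mono) auto
    then show ?thesis by (simp add: algebra_simps)
  qed
  obtain n where n: "3 ^ (q1 + q2) = Suc n"
    by (metis not0_implies_Suc power_not_zero zero_neq_numeral)
  have le: "(6 * l) ^ 3 ^ q \<le> (6 * l) ^ 3 ^ (q1 + q2)" if "q \<le> q1 + q2" for l q :: nat
  proof (cases "l = 0")
    case False
    then show ?thesis using that by (intro power_increasing) auto
  qed (simp add: power_0_left)
  have "(6 * l1) ^ 3 ^ q1 + (6 * l2) ^ 3 ^ q2 \<le> (6 * l1) ^ 3 ^ (q1 + q2) + (6 * l2) ^ 3 ^ (q1 + q2)"
    by (intro add_mono le) auto
  also have "\<dots> \<le> (6 * l1 + 6 * l2) ^ 3 ^ (q1 + q2)"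
    unfolding n by (rule superadd)
  also have "\<dots> \<le> (6 * (l1 + l2 + 1)) ^ 3 ^ (q1 + q2)"
    by (intro power_mono) auto
  finally show ?thesis .
qed

lemma subset_lessThan_Suc:
  assumes "{i. Suc i \<in> X} \<subseteq> {..<s}"
  shows "X \<subseteq> {..<Suc s}"
proof
  fix i assume "i \<in> X"
  then show "i \<in> {..<Suc s}"
    using assms by (cases i) auto
qed

lemma complexity_le_pa_sat:
  "pa_free_vars F \<subseteq> {..<s} \<Longrightarrow>
    complexity_le ((6 * pa_length F) ^ 3 ^ pa_quants F) s (\<lambda>v. pa_sat v F)"
proof (induction F arbitrary: s)
  case (PLess a b)
  then show ?case
    using complexity_le_mono[OF complexity_le_atom(2)[of a b s]] by simp
next
  case (PLe a b)
  then show ?case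
    using complexity_le_mono[OF complexity_le_atom(1)[of a b s]] by simp
next
  case (PNot F)
  then show ?case
    using complexity_le_mono[OF complexity_le_not[OF PNot.IH] power_mono[of "6 * pa_length F"]]
    by (simp del: power_mult_distrib)
next
  case (PAnd F G)
  then have "complexity_le ((6 * pa_length F) ^ 3 ^ pa_quants F + (6 * pa_length G) ^ 3 ^ pa_quants G) s
      (\<lambda>v. pa_sat v (PAnd F G))"
    by (intro complexity_le_combine[where P = "\<lambda>v. pa_sat v F" and Q = "\<lambda>v. pa_sat v G"]) auto
  from complexity_le_mono[OF this tower_connective_step] show ?case
    by (simp del: power_mult_distrib)
next
  case (POr F G)
  then have "complexity_le ((6 * pa_length F) ^ 3 ^ pa_quants F + (6 * pa_length G) ^ 3 ^ pa_quants G) s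
      (\<lambda>v. pa_sat v (POr F G))"
    by (intro complexity_le_combine[where P = "\<lambda>v. pa_sat v F" and Q = "\<lambda>v. pa_sat v G"]) auto
  from complexity_le_mono[OF this tower_connective_step] show ?case
    by (simp del: power_mult_distrib)
next
  case (PEx F)
  let ?R = "(6 * pa_length F) ^ 3 ^ pa_quants F"
  have "?R \<ge> 1" using pa_length_ge_1[of F] by simp
  moreover have "pa_free_vars F \<subseteq> {..<Suc s}"
    using PEx.prems unfolding pa_free_vars.simps by (rule subset_lessThan_Suc)
  ultimately have "complexity_le (6 * ?R\<^sup>2) s (\<lambda>v. \<exists>z. pa_sat (z # v) F)"
    by (intro complexity_le_ex PEx.IH)
  from complexity_le_mono[OF this tower_quantifier_step[OF pa_length_ge_1]] show ?case
    by (simp del: power_mult_distrib power_Suc)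
next
  case (PAll F)
  let ?R = "(6 * pa_length F) ^ 3 ^ pa_quants F"
  have "?R \<ge> 1" using pa_length_ge_1[of F] by simp
  moreover have "pa_free_vars F \<subseteq> {..<Suc s}"
    using PAll.prems unfolding pa_free_vars.simps by (rule subset_lessThan_Suc)
  \<comment> \<open>The universal quantifier is a negated existential one, and negations cost
    nothing.\<close>
  ultimately have "complexity_le (6 * ?R\<^sup>2) s (\<lambda>v. \<exists>z. \<not> pa_sat (z # v) F)"
    by (intro complexity_le_ex complexity_le_not PAll.IH)
  from complexity_le_mono[OF complexity_le_not[OF this] tower_quantifier_step[OF pa_length_ge_1]]
  show ?case
    by (simp del: power_mult_distrib power_Suc)
qed

section \<open>Counting the traces on a shattered set\<close>

text \<open>Upper segments of \<open>T\<close> form a chain, so one number records the position of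
  \<open>a\<close> among the thresholds.\<close>

lemma Collect_le_eq_if_card_eq:
  fixes a b :: "'a :: linorder"
  assumes "finite T" "card {t \<in> T. a \<le> t} = card {t \<in> T. b \<le> t}"
  shows "{t \<in> T. a \<le> t} = {t \<in> T. b \<le> t}"
proof -
  have "{t \<in> T. b \<le> t} \<subseteq> {t \<in> T. a \<le> t} \<or> {t \<in> T. a \<le> t} \<subseteq> {t \<in> T. b \<le> t}"
    using linear[of a b] by (auto intro: order_trans)
  moreover have "finite {t \<in> T. a \<le> t}" "finite {t \<in> T. b \<le> t}"
    using assms(1) by auto
  ultimately show ?thesis
    using card_subset_eq[of "{t \<in> T. a \<le> t}" "{t \<in> T. b \<le> t}"]
      card_subset_eq[of "{t \<in> T. b \<le> t}" "{t \<in> T. a \<le> t}"] assms(2) by argo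
qed

text \<open>For a fixed \<open>h\<close> the parameter \<open>y\<close> enters all inequalities \<open>lin h (x @ y) \<le> c\<close> through a
  single integer, which is compared with at most \<open>card A * (2 * K + 1)\<close> thresholds.\<close>

lemma card_shattered_le:
  assumes "finite A" "finite H" "D \<ge> 1" "K \<ge> 0" "determined (m + n) H K D P"
    and sh: "shattered {{x. length x = m \<and> P (x @ b)} |b. length b = n} A"
  shows "2 ^ card A \<le> nat D ^ n * Suc (card A * nat (2 * K + 1)) ^ card H"
proof -
  define S where "S y = {x. length x = m \<and> P (x @ y)}" for y
  define T where "T h = (\<lambda>(x, c). c - lin h x) ` (A \<times> {-K..K})" for h
  define f where "f h y = lin (\<lambda>i. h (m + i)) y" for h y
  \<comment> \<open>The signature of \<open>y\<close>: residues, and for each \<open>h\<close> in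
    \<open>H\<close> a threshold count. \<open>restrict\<close> places the second component in the
    finite set used in \<open>Sig\<close>.\<close>
  define sig where "sig y = (map (\<lambda>a. a mod D) y, restrict (\<lambda>h. card {t \<in> T h. f h y \<le> t}) H)" for y
  define N where "N = card A * nat (2 * K + 1)"
  define Sig where "Sig = {xs. set xs \<subseteq> {0..<D} \<and> length xs = n} \<times> (H \<rightarrow>\<^sub>E {..N})"
  have sh': "\<exists>y. length y = n \<and> B = S y \<inter> A" if "B \<subseteq> A" for B
    using sh that unfolding shattered_def S_def by blast
  \<comment> \<open>\<open>A\<close> is itself one of the traces, so it contains only points of the
    right dimension.\<close>
  have lenA: "length x = m" if "x \<in> A" for x
    using sh'[of A] that unfolding S_def by blast
  have T: "finite (T h)" "card (T h) \<le> N" for h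
  proof -
    show "finite (T h)" using assms(1) by (simp add: T_def)
    have "card (T h) \<le> card (A \<times> {-K..K})"
      unfolding T_def using assms(1) by (intro card_image_le) auto
    also have "\<dots> = N" using assms(4) by (simp add: N_def card_cartesian_product algebra_simps)
    finally show "card (T h) \<le> N" .
  qed
  have "S y \<inter> A = S y' \<inter> A" if "length y = n" "length y' = n" "sig y = sig y'" for y y'
  proof -
    have mods: "D dvd y ! i - y' ! i" if "i < n" for i
      using arg_cong[OF \<open>sig y = sig y'\<close>, of "\<lambda>p. fst p ! i"] that \<open>length y = n\<close> \<open>length y' = n\<close>
      by (simp add: sig_def mod_eq_dvd_iff)
    have sets: "{t \<in> T h. f h y \<le> t} = {t \<in> T h. f h y' \<le> t}" if "h \<in> H" for h
      using arg_cong[OF \<open>sig y = sig y'\<close>, of "\<lambda>p. snd p h"] that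
      by (intro Collect_le_eq_if_card_eq T) (simp add: sig_def)
    have "P (x @ y) = P (x @ y')" if x: "x \<in> A" for x
    proof -
      have "lin h (x @ y) \<le> c \<longleftrightarrow> lin h (x @ y') \<le> c" if "h \<in> H" "\<bar>c\<bar> \<le> K" for h c
      proof -
        have "c - lin h x \<in> T h"
          using that x unfolding T_def by (intro image_eqI[of _ _ "(x, c)"]) auto
        then have "f h y \<le> c - lin h x \<longleftrightarrow> f h y' \<le> c - lin h x"
          using sets[OF that(1)] by blast
        then show ?thesis
          by (simp add: lin_append lenA[OF x] f_def algebra_simps)
      qed
      moreover have "D dvd (x @ y) ! i - (x @ y') ! i" if "i < m + n" for i
        using mods[of "i - m"] that lenA[OF x] by (auto simp: nth_append)
      ultimately have "agree H K D (x @ y) (x @ y')"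
        unfolding agree_def using lenA[OF x] \<open>length y = n\<close> by simp
      then show ?thesis
        using assms(5) lenA[OF x] \<open>length y = n\<close> \<open>length y' = n\<close> unfolding determined_def by simp
    qed
    then show ?thesis unfolding S_def by blast
  qed
  moreover have "sig ` {y. length y = n} \<subseteq> Sig"
  proof -
    have "card {t \<in> T h. f h y \<le> t} \<le> N" for h y
      using T[of h] card_mono[of "T h" "{t \<in> T h. f h y \<le> t}"] by fastforce
    then show ?thesis
      using assms(3) by (auto simp: sig_def Sig_def)
  qed
  moreover have fin: "finite Sig"
    unfolding Sig_def using assms(2) by (intro finite_cartesian_product finite_lists_length_eq finite_PiE) auto
  \<comment> \<open>A chosen parameter for each signature maps \<open>Sig\<close> onto all traces,
    hence onto all subsets of \<open>A\<close>.\<close>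
  ultimately have "Pow A \<subseteq> (\<lambda>p. S (SOME y. length y = n \<and> sig y = p) \<inter> A) ` Sig"
  proof (intro subsetI)
    fix B assume "B \<in> Pow A"
    then obtain y where y: "length y = n" "B = S y \<inter> A" using sh' by blast
    define y' where "y' = (SOME y'. length y' = n \<and> sig y' = sig y)"
    have "length y' = n \<and> sig y' = sig y"
      unfolding y'_def by (rule someI[of _ y]) (simp add: y)
    then have "B = S y' \<inter> A"
      using y \<open>\<And>y y'. length y = n \<Longrightarrow> length y' = n \<Longrightarrow> sig y = sig y' \<Longrightarrow> S y \<inter> A = S y' \<inter> A\<close> by metis
    moreover have "sig y \<in> Sig"
      using y \<open>sig ` {y. length y = n} \<subseteq> Sig\<close> by blast
    ultimately show "B \<in> (\<lambda>p. S (SOME y. length y = n \<and> sig y = p) \<inter> A) ` Sig"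
      unfolding y'_def by blast
  qed
  then have "card (Pow A) \<le> card Sig"
    using fin by (rule surj_card_le[rotated])
  also have "card Sig = nat D ^ n * Suc N ^ card H"
    unfolding Sig_def using assms(2) by (simp add: card_cartesian_product card_lists_length_eq card_PiE)
  finally show ?thesis
    using assms(1) by (simp add: card_Pow N_def)
qed

section \<open>From the counting inequality to the polynomial bound\<close>

lemma le_if_exp_le:
  fixes N R n :: nat
  assumes "2 ^ N \<le> (2 ^ R) ^ n * Suc (N * (2 * 2 ^ R + 1)) ^ R" and R: "R \<ge> 1"
  shows "real N \<le> (28 + 4 * real n) * (real R)\<^sup>2"
proof (cases "N = 0")
  case False
  have le: "Suc (N * (2 * 2 ^ R + 1)) \<le> N * (4 * 2 ^ R)"
  proof -
    have "Suc (N * (2 * 2 ^ R + 1)) \<le> N * 1 + N * (2 * 2 ^ R + 1)" using False by simp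
    also have "\<dots> = N * (2 * 2 ^ R + 2)" by (simp add: algebra_simps)
    also have "\<dots> \<le> N * (4 * 2 ^ R)"
      using self_le_power[of 2 R] R by (intro mult_left_mono) auto
    finally show ?thesis .
  qed
  have split_power: "(2 ^ R) ^ n * (N * 2 ^ M) ^ R = 2 ^ (R * n + M * R) * N ^ R" for M
    by (simp add: power_add power_mult power_mult_distrib)
  have "2 ^ N \<le> (2 ^ R) ^ n * (N * (4 * 2 ^ R)) ^ R"
    using assms(1) le by (meson mult_le_mono2 order_trans power_mono zero_le)
  also have "4 * 2 ^ R = (2 :: nat) ^ (R + 2)"
    by simp
  also have "(2 ^ R) ^ n * (N * 2 ^ (R + 2)) ^ R = 2 ^ (R * n + (R + 2) * R) * N ^ R"
    by (rule split_power)
  finally have "real (2 ^ N) \<le> real (2 ^ (R * n + (R + 2) * R) * N ^ R)"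
    by (simp only: of_nat_le_iff)
  then have *: "ln (2 ^ N) \<le> ln (2 ^ (R * n + (R + 2) * R) * real N ^ R)"
    by (subst ln_le_cancel_iff) (use False in auto)
  define E where "E = real R * real n + (real R + 2) * real R"
  from * have 1: "real N * ln 2 \<le> E * ln 2 + real R * ln (real N)"
    using False by (simp add: ln_mult ln_realpow distrib_right E_def)
  \<comment> \<open>Scaling by \<open>4 * real R\<close> before using
    \<open>ln x \<le> x - 1\<close> makes \<open>real R * ln (real N)\<close> cost only
    \<open>real N / 4\<close>, while \<open>real N * ln 2\<close> is at least
    \<open>real N / 2\<close>.\<close>
  have "ln (real N / (4 * real R)) \<le> real N / (4 * real R) - 1"
    using False R by (intro ln_le_minus_one) auto
  moreover have "ln (4 * real R) \<le> 4 * real R - 1"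
    using R by (intro ln_le_minus_one) auto
  ultimately have "ln (real N) \<le> real N / (4 * real R) + 4 * real R"
    using False R by (simp add: ln_div)
  then have "real R * ln (real N) \<le> real R * (real N / (4 * real R) + 4 * real R)"
    by (intro mult_left_mono) auto
  also have "\<dots> = real N / 4 + 4 * (real R)\<^sup>2"
    using R by (simp add: field_simps power2_eq_square)
  finally have 2: "real R * ln (real N) \<le> real N / 4 + 4 * (real R)\<^sup>2" .
  have ln2: "ln 2 \<le> (1 :: real)" "ln 2 \<ge> (1 / 2 :: real)"
    using ln_le_minus_one[of 2] ln_le_minus_one[of "1/2 :: real"]
    by (auto simp: ln_div)
  have "real N * (1 / 2) \<le> real N * ln 2"
    using ln2 by (intro mult_left_mono) auto
  moreover have "E * ln 2 \<le> E * 1"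
    using ln2 by (intro mult_left_mono) (auto simp: E_def)
  ultimately have 3: "real N / 4 \<le> E + 4 * (real R)\<^sup>2"
    using 1 2 by linarith
  \<comment> \<open>Now \<open>E + 4 * (real R)\<^sup>2\<close> is at most
    \<open>(7 + real n) * (real R)\<^sup>2\<close>; multiplying by 4 gives the stated
    constant.\<close>
  have RR: "real R \<le> (real R)\<^sup>2"
    using R by (simp add: power2_eq_square)
  then have "real R * real n \<le> (real R)\<^sup>2 * real n"
    by (intro mult_right_mono) auto
  then show ?thesis
    using 3 RR by (simp add: E_def algebra_simps power2_eq_square)
qed simp

lemma card_shattered_pa_family_le:
  assumes "pa_partitioned m n F" "finite A" "shattered (pa_family m n F) A"
  shows "real (card A) \<le> (28 + 4 * real n) * (real ((6 * pa_length F) ^ 3 ^ pa_quants F))\<^sup>2"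
proof -
  define R where "R = (6 * pa_length F) ^ 3 ^ pa_quants F"
  have R: "R \<ge> 1" using pa_length_ge_1[of F] by (simp add: R_def)
  obtain H D where H: "finite H" "card H \<le> R" "1 \<le> D" "D \<le> 2 ^ R"
      "determined (m + n) H (2 ^ R) D (\<lambda>v. pa_sat v F)"
    using complexity_le_pa_sat[of F "m + n"] assms(1)
    unfolding complexity_le_def pa_partitioned_def R_def by blast
  define M where "M = Suc (card A * nat (2 * 2 ^ R + 1))"
  have "nat D \<le> nat (2 ^ R)" using H(4) by (rule nat_mono)
  then have "nat D \<le> 2 ^ R" by (simp add: nat_power_eq)
  have "2 ^ card A \<le> nat D ^ n * M ^ card H"
    unfolding M_def using assms(3)
    by (intro card_shattered_le[OF assms(2) H(1,3) _ H(5)]) (simp_all add: pa_family_def pa_set_def)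
  also have "\<dots> \<le> (2 ^ R) ^ n * M ^ R"
    using \<open>nat D \<le> 2 ^ R\<close> H(2)
    by (intro mult_le_mono power_mono power_increasing) (auto simp: M_def)
  also have "M = Suc (card A * (2 * 2 ^ R + 1))"
    by (simp add: M_def nat_add_distrib nat_mult_distrib nat_power_eq)
  finally show ?thesis
    using le_if_exp_le R unfolding R_def by blast
qed

theorem theorem4:
  fixes k :: nat
  assumes "k > 0"
  shows "\<exists>c C :: real. c > 0 \<and> C > 0 \<and>
    (\<forall>(m::nat) (n::nat) (F::pa_formula).
      pa_partitioned m n F \<and> m + n + pa_quants F \<le> k \<longrightarrow>
      ereal_of_enat (pa_vc m n F) \<le> ereal (C * real (pa_length F) powr c))"
\<comment> \<open>The exponent doubles \<open>3 ^ k\<close> because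
  \<open>card_shattered_pa_family_le\<close> squares the tower; \<open>n\<close> and the quantifier
  count are both at most \<open>k\<close>.\<close>
proof (rule exI[of _ "real (2 * 3 ^ k)"], rule exI[of _ "(28 + 4 * real k) * 6 ^ (2 * 3 ^ k)"],
    intro conjI allI impI)
  fix m n F
  assume F: "pa_partitioned m n F \<and> m + n + pa_quants F \<le> k"
  define L where "L = pa_length F"
  define X where "X = (28 + 4 * real k) * 6 ^ (2 * 3 ^ k) * real L ^ (2 * 3 ^ k)"
  have L: "L \<ge> 1" unfolding L_def by (rule pa_length_ge_1)
  have "real (card A) \<le> X" if A: "finite A" "shattered (pa_family m n F) A" for A
  proof -
    have "(6 * L) ^ 3 ^ pa_quants F \<le> (6 * L) ^ 3 ^ k"
      using L F by (intro power_increasing) auto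
    then have "real ((6 * L) ^ 3 ^ pa_quants F) \<le> real ((6 * L) ^ 3 ^ k)"
      by (simp only: of_nat_le_iff)
    then have "(28 + 4 * real n) * (real ((6 * L) ^ 3 ^ pa_quants F))\<^sup>2 \<le>
        (28 + 4 * real k) * (real ((6 * L) ^ 3 ^ k))\<^sup>2"
      using F by (intro mult_mono power_mono) auto
    also have "(real ((6 * L) ^ 3 ^ k))\<^sup>2 = 6 ^ (2 * 3 ^ k) * real L ^ (2 * 3 ^ k)"
      by (simp add: power_mult_distrib mult.commute flip: power_mult)
    finally show ?thesis
      using card_shattered_pa_family_le[of m n F A] F A unfolding L_def X_def by simp
  qed
  \<comment> \<open>The supremum lives in the extended naturals, so the real bound \<open>X\<close>
    passes through its floor.\<close>
  then have "pa_vc m n F \<le> enat (nat \<lfloor>X\<rfloor>)"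
    unfolding pa_vc_def vc_dim_def by (auto intro!: SUP_least simp: le_nat_floor)
  then have "ereal_of_enat (pa_vc m n F) \<le> ereal_of_enat (enat (nat \<lfloor>X\<rfloor>))"
    by (simp only: ereal_of_enat_le_iff)
  also have "\<dots> \<le> ereal X"
    by (simp add: X_def of_nat_floor)
  also have "X = (28 + 4 * real k) * 6 ^ (2 * 3 ^ k) * real L powr real (2 * 3 ^ k)"
    using L by (subst powr_realpow) (auto simp: X_def)
  finally show "ereal_of_enat (pa_vc m n F) \<le>
      ereal ((28 + 4 * real k) * 6 ^ (2 * 3 ^ k) * real (pa_length F) powr real (2 * 3 ^ k))"
    by (simp add: L_def)
qed auto

end
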